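(* Let $(\Lambda,d)$ be a topological $k$-graph. Then the set $\partial\Lambda$ of boundary paths is closed in $G_\Lambda^{(0)}=X_\Lambda$.
   Context: Conventions: $\mathbb{N}=\{0,1,2,\dots\}$; on $(\mathbb{N}\cup\{\infty\})^k$, $\le$ is the coordinatewise order and $\vee,\wedge$ are coordinatewise max and min. Topological $k$-graph ($k\in\mathbb{N}$): a pair $(\Lambda,d)$ of a small category $\Lambda$ (range = codomain map $r$, source = domain map $s$; $\lambda\mu$ is defined when $s(\lambda)=r(\mu)$) and a functor $d:\Lambda\to\mathbb{N}^k$ such that: (1) the object and morphism sets are second-countable locally compact Hausdorff spaces; (2) $r,s$ are continuous and $s$ is a local homeomorphism; (3) composition, from the set of composable pairs with the relative product topology, is continuous and open; (4) $d$ is continuous, $\mathbb{N}^k$ being discrete; (5) if $d(\lambda)=m+n$ there is a unique composable pair $(\xi,\eta)$ with $\lambda=\xi\eta$, $d(\xi)=m$, $d(\eta)=n$. $\Lambda$ also denotes the morphism set, objects are identified with identity morphisms, $\Lambda^m:=d^{-1}(\{m\})$ (so $\Lambda^0$ is the object set), and $UV:=\{\lambda\mu:\lambda\in U,\mu\in V,s(\lambda)=r(\mu)\}$ for $U,V\subset\Lambda$. Path space: for $m\in(\mathbb{N}\cup\{\infty\})^k$ let $\Omega_{k,m}$ be the discrete topological $k$-graph with objects $\{p\in\mathbb{N}^k:p\le m\}$, morphisms $\{(p,q)\in\mathbb{N}^k\times\mathbb{N}^k:p\le q\le m\}$, $r(p,q)=p$, $s(p,q)=q$, $(n,p)(p,q)=(n,q)$,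 $d(p,q)=q-p$. $X_\Lambda$ is the set of all degree-preserving (continuous) functors $x:\Omega_{k,m}\to\Lambda$, $m\in(\mathbb{N}\cup\{\infty\})^k$; put $d(x)=m$, $r(x)=x(0)$. For $\lambda\in\Lambda$ with $s(\lambda)=r(x)$, $\lambda x\in X_\Lambda$ is the unique path of degree $d(\lambda)+d(x)$ with $(\lambda x)(0,d(\lambda))=\lambda$ and $(\lambda x)(d(\lambda),d(\lambda)+p)=x(0,p)$ for $p\in\mathbb{N}^k$, $p\le d(x)$. Topology: the path groupoid $G_\Lambda$ has unit space $X_\Lambda$ (with $x$ identified with $(x,0,x)$) and morphisms $(\lambda x,d(\lambda)-d(\mu),\mu x)\in X_\Lambda\times\mathbb{Z}^k\times X_\Lambda$ with $s(\lambda)=s(\mu)=r(x)$. Let $\Lambda*_s\Lambda:=\{(\lambda,\mu):s(\lambda)=s(\mu)\}$, $U*_sV:=(U\times V)\cap(\Lambda*_s\Lambda)$, and $Z(F,m):=\{(\lambda x,d(\lambda)-d(\mu),\mu x)\in G_\Lambda:(\lambda,\mu)\in F,\ d(\lambda)-d(\mu)=m\}$ for $F\subset\Lambda*_s\Lambda$, $m\in\mathbb{Z}^k$. $G_\Lambda$ has the topology with basis $Z(U*_sV,m)\cap Z(F,m)^c$ ($m\in\mathbb{Z}^k$, $U,V\subset\Lambda$ open, $F\subset\Lambda*_s\Lambda$ compact), and $G_\Lambda^{(0)}=X_\Lambda$ has the relative topology; equivalently, with $Z(U):=\{x\in X_\Lambda: x(0,d(\lambda))=\lambda\text{ for some }\lambda\in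 U,\ d(\lambda)\le d(x)\}$, the sets $Z(U)\cap Z(F)^c$ with $U\subset\Lambda$ open and $F\subset\Lambda$ compact form a basis. Boundary paths: $\Lambda^{\min}(\lambda,\mu):=\{(\alpha,\beta):\lambda\alpha=\mu\beta,\ d(\lambda\alpha)=d(\lambda)\vee d(\mu)\}$. For $V\subset\Lambda^0$, a set $E\subset V\Lambda$ is exhaustive for $V$ if for every $\lambda\in V\Lambda$ there is $\mu\in E$ with $\Lambda^{\min}(\lambda,\mu)\neq\emptyset$. For $v\in\Lambda^0$, $v\mathcal{CE}(\Lambda)$ is the set of compact $E\subset\Lambda$ such that $r(E)$ is a neighbourhood of $v$ and $E$ is exhaustive for $r(E)$. $x\in X_\Lambda$ is a boundary path if for all $m\in\mathbb{N}^k$ with $m\le d(x)$ and all $E\in x(m)\mathcal{CE}(\Lambda)$ there is $\lambda\in E$ with $x(m,m+d(\lambda))=\lambda$. $\partial\Lambda$ is the set of boundary paths. *)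

theory Defs
  imports "HOL-Analysis.Analysis" "HOL-Library.Function_Algebras"
begin

section \<open>Degrees\<close>

text \<open>
  Vectors of length \<open>k\<close> (with \<open>k = 0\<close> allowed) are functions on \<^typ>\<open>nat\<close> that vanish from
  index \<open>k\<close> on.  On such functions the pointwise \<open>+\<close>, \<open>\<le>\<close> and \<open>sup\<close> of the function type are
  the coordinatewise sum, order and maximum.
\<close>

definition nat_vecs :: "nat \<Rightarrow> (nat \<Rightarrow> nat) set" where
  "nat_vecs k = {m. \<forall>i\<ge>k. m i = 0}"

definition enat_vecs :: "nat \<Rightarrow> (nat \<Rightarrow> enat) set" where
  "enat_vecs k = {m. \<forall>i\<ge>k. m i = 0}"

definition int_vecs :: "nat \<Rightarrow> (nat \<Rightarrow> int) set" where
  "int_vecs k = {m. \<forall>i\<ge>k. m i = 0}"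

definition enat_vec :: "(nat \<Rightarrow> nat) \<Rightarrow> nat \<Rightarrow> enat" where
  "enat_vec m = (\<lambda>i. enat (m i))"

definition deg_diff :: "(nat \<Rightarrow> nat) \<Rightarrow> (nat \<Rightarrow> nat) \<Rightarrow> nat \<Rightarrow> int" where
  "deg_diff m n = (\<lambda>i. int (m i) - int (n i))"


section \<open>Topological higher-rank graphs\<close>

text \<open>
  Objects are identified with identity morphisms, so that \<open>topspace obj\<close> is a subset of
  \<open>topspace mor\<close>.  The topology \<open>obj\<close> on objects is a separate datum: it is not assumed to be
  the subspace topology.
\<close>

record 'a graph_data =
  mor :: "'a topology"
  obj :: "'a topology"
  rng :: "'a \<Rightarrow> 'a"
  src :: "'a \<Rightarrow> 'a"
  cmp :: "'a \<Rightarrow> 'a \<Rightarrow> 'a"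
  deg :: "'a \<Rightarrow> nat \<Rightarrow> nat"

abbreviation Mor :: "('a, 'z) graph_data_scheme \<Rightarrow> 'a set" where
  "Mor \<Lambda> \<equiv> topspace (mor \<Lambda>)"

abbreviation Obj :: "('a, 'z) graph_data_scheme \<Rightarrow> 'a set" where
  "Obj \<Lambda> \<equiv> topspace (obj \<Lambda>)"

definition composable :: "('a, 'z) graph_data_scheme \<Rightarrow> ('a \<times> 'a) set" where
  "composable \<Lambda> = {(\<kappa>, \<mu>). \<kappa> \<in> Mor \<Lambda> \<and> \<mu> \<in> Mor \<Lambda> \<and> src \<Lambda> \<kappa> = rng \<Lambda> \<mu>}"

definition set_cmp :: "('a, 'z) graph_data_scheme \<Rightarrow> 'a set \<Rightarrow> 'a set \<Rightarrow> 'a set" where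
  "set_cmp \<Lambda> U V = {cmp \<Lambda> \<kappa> \<mu> | \<kappa> \<mu>. (\<kappa>, \<mu>) \<in> composable \<Lambda> \<and> \<kappa> \<in> U \<and> \<mu> \<in> V}"

definition local_homeomorphism :: "'a topology \<Rightarrow> 'b topology \<Rightarrow> ('a \<Rightarrow> 'b) \<Rightarrow> bool" where
  "local_homeomorphism X Y f \<longleftrightarrow>
    (\<forall>x \<in> topspace X. \<exists>U. openin X U \<and> x \<in> U \<and> openin Y (f ` U) \<and>
      homeomorphic_map (subtopology X U) (subtopology Y (f ` U)) f)"

locale small_category =
  fixes \<Lambda> :: "('a, 'z) graph_data_scheme" (structure)
  assumes Obj_subset_Mor: "Obj \<Lambda> \<subseteq> Mor \<Lambda>"
    and rng_in_Obj: "\<kappa> \<in> Mor \<Lambda> \<Longrightarrow> rng \<Lambda> \<kappa> \<in> Obj \<Lambda>"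
    and src_in_Obj: "\<kappa> \<in> Mor \<Lambda> \<Longrightarrow> src \<Lambda> \<kappa> \<in> Obj \<Lambda>"
    and rng_Obj: "v \<in> Obj \<Lambda> \<Longrightarrow> rng \<Lambda> v = v"
    and src_Obj: "v \<in> Obj \<Lambda> \<Longrightarrow> src \<Lambda> v = v"
    and cmp_in_Mor: "(\<kappa>, \<mu>) \<in> composable \<Lambda> \<Longrightarrow> cmp \<Lambda> \<kappa> \<mu> \<in> Mor \<Lambda>"
    and rng_cmp: "(\<kappa>, \<mu>) \<in> composable \<Lambda> \<Longrightarrow> rng \<Lambda> (cmp \<Lambda> \<kappa> \<mu>) = rng \<Lambda> \<kappa>"
    and src_cmp: "(\<kappa>, \<mu>) \<in> composable \<Lambda> \<Longrightarrow> src \<Lambda> (cmp \<Lambda> \<kappa> \<mu>) = src \<Lambda> \<mu>"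
    and cmp_assoc: "(\<kappa>, \<mu>) \<in> composable \<Lambda> \<Longrightarrow> (\<mu>, \<nu>) \<in> composable \<Lambda> \<Longrightarrow>
      cmp \<Lambda> (cmp \<Lambda> \<kappa> \<mu>) \<nu> = cmp \<Lambda> \<kappa> (cmp \<Lambda> \<mu> \<nu>)"
    and cmp_rng: "\<kappa> \<in> Mor \<Lambda> \<Longrightarrow> cmp \<Lambda> (rng \<Lambda> \<kappa>) \<kappa> = \<kappa>"
    and cmp_src: "\<kappa> \<in> Mor \<Lambda> \<Longrightarrow> cmp \<Lambda> \<kappa> (src \<Lambda> \<kappa>) = \<kappa>"

locale topological_k_graph = small_category \<Lambda>
  for k :: nat and \<Lambda> :: "('a, 'z) graph_data_scheme" (structure) +
  assumes deg_Obj: "v \<in> Obj \<Lambda> \<Longrightarrow> deg \<Lambda> v = 0"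
    and deg_cmp: "(\<kappa>, \<mu>) \<in> composable \<Lambda> \<Longrightarrow> deg \<Lambda> (cmp \<Lambda> \<kappa> \<mu>) = deg \<Lambda> \<kappa> + deg \<Lambda> \<mu>"
    and second_countable_obj: "second_countable (obj \<Lambda>)"
    and locally_compact_obj: "locally_compact_space (obj \<Lambda>)"
    and Hausdorff_obj: "Hausdorff_space (obj \<Lambda>)"
    and second_countable_mor: "second_countable (mor \<Lambda>)"
    and locally_compact_mor: "locally_compact_space (mor \<Lambda>)"
    and Hausdorff_mor: "Hausdorff_space (mor \<Lambda>)"
    and continuous_rng: "continuous_map (mor \<Lambda>) (obj \<Lambda>) (rng \<Lambda>)"
    and continuous_src: "continuous_map (mor \<Lambda>) (obj \<Lambda>) (src \<Lambda>)"
    and local_homeomorphism_src: "local_homeomorphism (mor \<Lambda>) (obj \<Lambda>) (src \<Lambda>)"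
    and continuous_cmp:
      "continuous_map (subtopology (prod_topology (mor \<Lambda>) (mor \<Lambda>)) (composable \<Lambda>)) (mor \<Lambda>)
        (\<lambda>(\<kappa>, \<mu>). cmp \<Lambda> \<kappa> \<mu>)"
    and open_cmp:
      "open_map (subtopology (prod_topology (mor \<Lambda>) (mor \<Lambda>)) (composable \<Lambda>)) (mor \<Lambda>)
        (\<lambda>(\<kappa>, \<mu>). cmp \<Lambda> \<kappa> \<mu>)"
    and continuous_deg: "continuous_map (mor \<Lambda>) (discrete_topology (nat_vecs k)) (deg \<Lambda>)"
    and unique_factorization:
      "\<kappa> \<in> Mor \<Lambda> \<Longrightarrow> m \<in> nat_vecs k \<Longrightarrow> n \<in> nat_vecs k \<Longrightarrow> deg \<Lambda> \<kappa> = m + n \<Longrightarrow>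
        \<exists>!p. p \<in> composable \<Lambda> \<and> \<kappa> = cmp \<Lambda> (fst p) (snd p) \<and>
          deg \<Lambda> (fst p) = m \<and> deg \<Lambda> (snd p) = n"


section \<open>Path space\<close>

text \<open>In \<open>\<Omega>\<^sub>k\<^sub>,\<^sub>m\<close> the object \<open>p\<close> is identified with the morphism \<open>(p, p)\<close>.\<close>

definition Omega :: "nat \<Rightarrow> (nat \<Rightarrow> enat) \<Rightarrow> ((nat \<Rightarrow> nat) \<times> (nat \<Rightarrow> nat)) graph_data" where
  "Omega k m = \<lparr>
    mor = discrete_topology
      {(p, q). p \<in> nat_vecs k \<and> q \<in> nat_vecs k \<and> p \<le> q \<and> enat_vec q \<le> m},
    obj = discrete_topology {(p, p) | p. p \<in> nat_vecs k \<and> enat_vec p \<le> m},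
    rng = (\<lambda>(p, q). (p, p)),
    src = (\<lambda>(p, q). (q, q)),
    cmp = (\<lambda>(n, p) (p', q). (n, q)),
    deg = (\<lambda>(p, q). q - p)\<rparr>"

definition degree_functor ::
    "('b, 'y) graph_data_scheme \<Rightarrow> ('a, 'z) graph_data_scheme \<Rightarrow> ('b \<Rightarrow> 'a) \<Rightarrow> bool" where
  "degree_functor \<Gamma> \<Lambda> f \<longleftrightarrow>
    continuous_map (mor \<Gamma>) (mor \<Lambda>) f \<and> continuous_map (obj \<Gamma>) (obj \<Lambda>) f \<and>
    (\<forall>\<kappa> \<in> Mor \<Gamma>. rng \<Lambda> (f \<kappa>) = f (rng \<Gamma> \<kappa>) \<and> src \<Lambda> (f \<kappa>) = f (src \<Gamma> \<kappa>) \<and>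
      deg \<Lambda> (f \<kappa>) = deg \<Gamma> \<kappa>) \<and>
    (\<forall>(\<kappa>, \<mu>) \<in> composable \<Gamma>. f (cmp \<Gamma> \<kappa> \<mu>) = cmp \<Lambda> (f \<kappa>) (f \<mu>))"

text \<open>
  A path is a pair of its degree and a functor on the corresponding \<^const>\<open>Omega\<close>; the functor is
  \<^const>\<open>undefined\<close> outside its domain, so that equality of paths is equality of functors.
\<close>

type_synonym 'a path = "(nat \<Rightarrow> enat) \<times> ((nat \<Rightarrow> nat) \<times> (nat \<Rightarrow> nat) \<Rightarrow> 'a)"

definition paths :: "nat \<Rightarrow> ('a, 'z) graph_data_scheme \<Rightarrow> 'a path set" where
  "paths k \<Lambda> = {(m, x). m \<in> enat_vecs k \<and> degree_functor (Omega k m) \<Lambda> x \<and>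
    x \<in> extensional (Mor (Omega k m))}"

abbreviation path_deg :: "'a path \<Rightarrow> nat \<Rightarrow> enat" where
  "path_deg x \<equiv> fst x"

abbreviation segment :: "'a path \<Rightarrow> (nat \<Rightarrow> nat) \<Rightarrow> (nat \<Rightarrow> nat) \<Rightarrow> 'a" where
  "segment x p q \<equiv> snd x (p, q)"

abbreviation vertex :: "'a path \<Rightarrow> (nat \<Rightarrow> nat) \<Rightarrow> 'a" where
  "vertex x p \<equiv> segment x p p"

text \<open>The path \<open>\<kappa>x\<close>, meaningful if \<open>src \<Lambda> \<kappa> = vertex x 0\<close>.\<close>

definition path_cons :: "nat \<Rightarrow> ('a, 'z) graph_data_scheme \<Rightarrow> 'a \<Rightarrow> 'a path \<Rightarrow> 'a path" where
  "path_cons k \<Lambda> \<kappa> x = (THE y. y \<in> paths k \<Lambda> \<and>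
    path_deg y = enat_vec (deg \<Lambda> \<kappa>) + path_deg x \<and>
    segment y 0 (deg \<Lambda> \<kappa>) = \<kappa> \<and>
    (\<forall>p \<in> nat_vecs k. enat_vec p \<le> path_deg x \<longrightarrow>
      segment y (deg \<Lambda> \<kappa>) (deg \<Lambda> \<kappa> + p) = segment x 0 p))"


section \<open>Path groupoid and its topology\<close>

definition src_prod :: "('a, 'z) graph_data_scheme \<Rightarrow> 'a set \<Rightarrow> 'a set \<Rightarrow> ('a \<times> 'a) set" where
  "src_prod \<Lambda> U V = {(\<kappa>, \<mu>) \<in> U \<times> V. \<kappa> \<in> Mor \<Lambda> \<and> \<mu> \<in> Mor \<Lambda> \<and> src \<Lambda> \<kappa> = src \<Lambda> \<mu>}"

definition path_groupoid ::
    "nat \<Rightarrow> ('a, 'z) graph_data_scheme \<Rightarrow> ('a path \<times> (nat \<Rightarrow> int) \<times> 'a path) set" where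
  "path_groupoid k \<Lambda> =
    {(path_cons k \<Lambda> \<kappa> x, deg_diff (deg \<Lambda> \<kappa>) (deg \<Lambda> \<mu>), path_cons k \<Lambda> \<mu> x) | \<kappa> \<mu> x.
      \<kappa> \<in> Mor \<Lambda> \<and> \<mu> \<in> Mor \<Lambda> \<and> x \<in> paths k \<Lambda> \<and> src \<Lambda> \<kappa> = src \<Lambda> \<mu> \<and> src \<Lambda> \<mu> = vertex x 0}"

definition cylinder ::
    "nat \<Rightarrow> ('a, 'z) graph_data_scheme \<Rightarrow> ('a \<times> 'a) set \<Rightarrow> (nat \<Rightarrow> int) \<Rightarrow>
      ('a path \<times> (nat \<Rightarrow> int) \<times> 'a path) set" where
  "cylinder k \<Lambda> F m =
    {(path_cons k \<Lambda> \<kappa> x, deg_diff (deg \<Lambda> \<kappa>) (deg \<Lambda> \<mu>), path_cons k \<Lambda> \<mu> x) | \<kappa> \<mu> x.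
      (\<kappa>, \<mu>) \<in> F \<and> \<kappa> \<in> Mor \<Lambda> \<and> \<mu> \<in> Mor \<Lambda> \<and> x \<in> paths k \<Lambda> \<and>
      src \<Lambda> \<kappa> = src \<Lambda> \<mu> \<and> src \<Lambda> \<mu> = vertex x 0 \<and> deg_diff (deg \<Lambda> \<kappa>) (deg \<Lambda> \<mu>) = m}"

text \<open>
  The generating family below is already a basis, so generating from it as a subbasis yields the
  topology consisting of its unions.
\<close>

definition path_groupoid_topology ::
    "nat \<Rightarrow> ('a, 'z) graph_data_scheme \<Rightarrow> ('a path \<times> (nat \<Rightarrow> int) \<times> 'a path) topology" where
  "path_groupoid_topology k \<Lambda> = topology_generated_by
    {cylinder k \<Lambda> (src_prod \<Lambda> U V) m \<inter> (path_groupoid k \<Lambda> - cylinder k \<Lambda> F m) | U V F m.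
      m \<in> int_vecs k \<and> openin (mor \<Lambda>) U \<and> openin (mor \<Lambda>) V \<and>
      compactin (subtopology (prod_topology (mor \<Lambda>) (mor \<Lambda>)) (src_prod \<Lambda> (Mor \<Lambda>) (Mor \<Lambda>))) F}"

text \<open>The relative topology on the unit space, transported along \<open>x \<mapsto> (x, 0, x)\<close>.\<close>

definition path_space :: "nat \<Rightarrow> ('a, 'z) graph_data_scheme \<Rightarrow> 'a path topology" where
  "path_space k \<Lambda> =
    pullback_topology (paths k \<Lambda>) (\<lambda>x. (x, 0, x)) (path_groupoid_topology k \<Lambda>)"


section \<open>Boundary paths\<close>

definition min_ext :: "('a, 'z) graph_data_scheme \<Rightarrow> 'a \<Rightarrow> 'a \<Rightarrow> ('a \<times> 'a) set" where
  "min_ext \<Lambda> \<kappa> \<mu> = {(\<alpha>, \<beta>). (\<kappa>, \<alpha>) \<in> composable \<Lambda> \<and> (\<mu>, \<beta>) \<in> composable \<Lambda> \<and>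
    cmp \<Lambda> \<kappa> \<alpha> = cmp \<Lambda> \<mu> \<beta> \<and> deg \<Lambda> (cmp \<Lambda> \<kappa> \<alpha>) = sup (deg \<Lambda> \<kappa>) (deg \<Lambda> \<mu>)}"

definition exhaustive :: "('a, 'z) graph_data_scheme \<Rightarrow> 'a set \<Rightarrow> 'a set \<Rightarrow> bool" where
  "exhaustive \<Lambda> V E \<longleftrightarrow> E \<subseteq> set_cmp \<Lambda> V (Mor \<Lambda>) \<and>
    (\<forall>\<kappa> \<in> set_cmp \<Lambda> V (Mor \<Lambda>). \<exists>\<mu> \<in> E. min_ext \<Lambda> \<kappa> \<mu> \<noteq> {})"

definition compact_exhaustive :: "('a, 'z) graph_data_scheme \<Rightarrow> 'a \<Rightarrow> 'a set set" where
  "compact_exhaustive \<Lambda> v = {E. compactin (mor \<Lambda>) E \<and>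
    (\<exists>W. openin (obj \<Lambda>) W \<and> v \<in> W \<and> W \<subseteq> rng \<Lambda> ` E) \<and> exhaustive \<Lambda> (rng \<Lambda> ` E) E}"

definition boundary_paths :: "nat \<Rightarrow> ('a, 'z) graph_data_scheme \<Rightarrow> 'a path set" where
  "boundary_paths k \<Lambda> = {x \<in> paths k \<Lambda>.
    \<forall>m \<in> nat_vecs k. enat_vec m \<le> path_deg x \<longrightarrow>
      (\<forall>E \<in> compact_exhaustive \<Lambda> (vertex x m). \<exists>\<kappa> \<in> E.
        enat_vec (m + deg \<Lambda> \<kappa>) \<le> path_deg x \<and> segment x m (m + deg \<Lambda> \<kappa>) = \<kappa>)}"

end

theory Submission
  imports Defs
begin

text \<open>
  If \<open>x\<close> is not a boundary path, some \<open>m \<le> d(x)\<close> and some compact exhaustive \<open>E\<close> over a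
  neighbourhood \<open>W\<close> of \<open>x(m)\<close> witness this.  Choose a compact neighbourhood \<open>K\<close> of \<open>x(0,m)\<close>
  inside the open set of morphisms of degree \<open>m\<close> with source in \<open>W\<close>.  The set \<open>KE\<close> is compact, so
  the paths starting in the interior of \<open>K\<close> but not in \<open>KE\<close> form an open neighbourhood of \<open>x\<close>;
  for each of them the same \<open>m\<close> and \<open>E\<close> violate the boundary condition.
\<close>

section \<open>Degrees\<close>

lemma nat_vecs_mono: "q \<in> nat_vecs k \<Longrightarrow> p \<le> q \<Longrightarrow> p \<in> nat_vecs k"
  by (auto simp: nat_vecs_def le_fun_def) (metis le_zero_eq)

lemma zero_in_nat_vecs [simp]: "0 \<in> nat_vecs k"
  by (simp add: nat_vecs_def)

lemma add_in_nat_vecs: "p \<in> nat_vecs k \<Longrightarrow> q \<in> nat_vecs k \<Longrightarrow> p + q \<in> nat_vecs k"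
  by (simp add: nat_vecs_def)

lemma diff_in_nat_vecs: "p \<in> nat_vecs k \<Longrightarrow> p - q \<in> nat_vecs k"
  by (simp add: nat_vecs_def)

lemma zero_le_vec [simp]: "0 \<le> (p :: nat \<Rightarrow> nat)"
  by (simp add: le_fun_def)

lemma enat_vec_zero_le [simp]: "enat_vec 0 \<le> m"
  by (simp add: le_fun_def enat_vec_def flip: zero_enat_def)

lemma enat_vec_mono: "p \<le> q \<Longrightarrow> enat_vec q \<le> m \<Longrightarrow> enat_vec p \<le> m"
  unfolding enat_vec_def le_fun_def by (meson enat_ord_simps(1) order_trans)

lemma add_diff_vec: "p \<le> q \<Longrightarrow> p + (q - p) = (q :: nat \<Rightarrow> nat)"
  by (simp add: fun_eq_iff le_fun_def)

lemma le_add_diff_vec: "q \<le> n + (q - n :: nat \<Rightarrow> nat)"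
  by (auto simp: le_fun_def)

lemma le_add_vec: "p \<le> p + (q :: nat \<Rightarrow> nat)"
  by (simp add: le_fun_def)

lemma diff_mono_vec: "p \<le> q \<Longrightarrow> p - n \<le> (q - n :: nat \<Rightarrow> nat)"
  by (simp add: le_fun_def diff_le_mono)

lemma add_mono_vec: "p \<le> q \<Longrightarrow> n + p \<le> (n + q :: nat \<Rightarrow> nat)"
  by (simp add: le_fun_def)

text \<open>In a coordinate with \<open>q i < n i\<close> the truncated difference is 0, so the
  bound survives there as well. This is what places \<open>q - deg \<Lambda> \<kappa>\<close> in the
  domain of \<open>x\<close> whenever \<open>q\<close> lies in the domain of
  \<open>\<kappa>x\<close>.\<close>

lemma enat_vec_diff_le:
  assumes "enat_vec q \<le> enat_vec n + m"
  shows "enat_vec (q - n) \<le> m"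
  unfolding le_fun_def
proof
  fix i
  have "enat (q i) \<le> enat (n i) + m i"
    using assms by (simp add: enat_vec_def le_fun_def)
  then show "enat_vec (q - n) i \<le> m i"
    by (cases "m i") (auto simp: enat_vec_def)
qed

lemma enat_vec_add_le:
  assumes "enat_vec p \<le> m"
  shows "enat_vec (n + p) \<le> enat_vec n + m"
  unfolding le_fun_def
proof
  fix i
  have "enat (p i) \<le> m i"
    using assms by (simp add: enat_vec_def le_fun_def)
  then show "enat_vec (n + p) i \<le> (enat_vec n + m) i"
    by (cases "m i") (auto simp: enat_vec_def)
qed

text \<open>An infinite coordinate stays infinite after a finite amount is subtracted, so the degree
  of a path can be split at any finite \<open>n\<close> below it.\<close>

lemma enat_vec_add_diff:
  assumes "enat_vec n \<le> m"
  shows "enat_vec n + (m - enat_vec n) = m"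
proof
  fix i
  have "enat (n i) \<le> m i"
    using assms by (simp add: enat_vec_def le_fun_def)
  then show "(enat_vec n + (m - enat_vec n)) i = m i"
    by (cases "m i") (auto simp: enat_vec_def)
qed

lemma deg_diff_eq_0_iff: "deg_diff m n = 0 \<longleftrightarrow> m = n"
  by (auto simp: deg_diff_def fun_eq_iff)

section \<open>Factors of morphisms\<close>

text \<open>For \<open>p \<le> q \<le> deg \<Lambda> \<kappa>\<close> the middle factor is the
  morphism usually written \<kappa>(p,q): \<open>p\<close> and \<open>q\<close> are positions
  counted from the range end, not degrees of the pieces.\<close>

definition is_factor ::
    "('a, 'z) graph_data_scheme \<Rightarrow> 'a \<Rightarrow> (nat \<Rightarrow> nat) \<Rightarrow> (nat \<Rightarrow> nat) \<Rightarrow> 'a \<Rightarrow> bool" where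
  "is_factor \<Lambda> \<kappa> p q \<beta> \<longleftrightarrow> (\<exists>\<alpha> \<gamma>. (\<alpha>, \<beta>) \<in> composable \<Lambda> \<and> (\<beta>, \<gamma>) \<in> composable \<Lambda> \<and>
    \<kappa> = cmp \<Lambda> \<alpha> (cmp \<Lambda> \<beta> \<gamma>) \<and> deg \<Lambda> \<alpha> = p \<and> p + deg \<Lambda> \<beta> = q)"

definition factor ::
    "('a, 'z) graph_data_scheme \<Rightarrow> 'a \<Rightarrow> (nat \<Rightarrow> nat) \<Rightarrow> (nat \<Rightarrow> nat) \<Rightarrow> 'a" where
  "factor \<Lambda> \<kappa> p q = (THE \<beta>. is_factor \<Lambda> \<kappa> p q \<beta>)"

context small_category
begin

lemma composable_cmp_right:
  "(\<alpha>, \<beta>) \<in> composable \<Lambda> \<Longrightarrow> (\<beta>, \<gamma>) \<in> composable \<Lambda> \<Longrightarrow> (\<alpha>, cmp \<Lambda> \<beta> \<gamma>) \<in> composable \<Lambda>"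
  using cmp_in_Mor[of \<beta> \<gamma>] rng_cmp[of \<beta> \<gamma>] by (auto simp: composable_def)

lemma composable_cmp_left:
  "(\<alpha>, \<beta>) \<in> composable \<Lambda> \<Longrightarrow> (\<beta>, \<gamma>) \<in> composable \<Lambda> \<Longrightarrow> (cmp \<Lambda> \<alpha> \<beta>, \<gamma>) \<in> composable \<Lambda>"
  using cmp_in_Mor[of \<alpha> \<beta>] src_cmp[of \<alpha> \<beta>] by (auto simp: composable_def)

lemma composable_src: "\<kappa> \<in> Mor \<Lambda> \<Longrightarrow> (\<kappa>, src \<Lambda> \<kappa>) \<in> composable \<Lambda>"
  using src_in_Obj[of \<kappa>] Obj_subset_Mor rng_Obj[of "src \<Lambda> \<kappa>"] by (auto simp: composable_def)

lemma composable_rng: "\<kappa> \<in> Mor \<Lambda> \<Longrightarrow> (rng \<Lambda> \<kappa>, \<kappa>) \<in> composable \<Lambda>"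
  using rng_in_Obj[of \<kappa>] Obj_subset_Mor src_Obj[of "rng \<Lambda> \<kappa>"] by (auto simp: composable_def)

end

context topological_k_graph
begin

lemma deg_in_nat_vecs: "\<kappa> \<in> Mor \<Lambda> \<Longrightarrow> deg \<Lambda> \<kappa> \<in> nat_vecs k"
  using continuous_deg by (auto simp: continuous_map_def)

text \<open>The axiom prescribes both degrees. Prescribing the first suffices, because cancellation
  in the degrees then forces the second.\<close>

lemma factorization_unique:
  assumes "(\<alpha>, \<beta>) \<in> composable \<Lambda>" "(\<alpha>', \<beta>') \<in> composable \<Lambda>"
    and "cmp \<Lambda> \<alpha> \<beta> = cmp \<Lambda> \<alpha>' \<beta>'" "deg \<Lambda> \<alpha> = deg \<Lambda> \<alpha>'"
  shows "\<alpha> = \<alpha>' \<and> \<beta> = \<beta>'"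
proof -
  have Mor: "\<alpha> \<in> Mor \<Lambda>" "\<beta> \<in> Mor \<Lambda>"
    using assms(1) by (auto simp: composable_def)
  have deg1: "deg \<Lambda> (cmp \<Lambda> \<alpha> \<beta>) = deg \<Lambda> \<alpha> + deg \<Lambda> \<beta>"
    and deg2: "deg \<Lambda> (cmp \<Lambda> \<alpha> \<beta>) = deg \<Lambda> \<alpha>' + deg \<Lambda> \<beta>'"
    using deg_cmp[OF assms(1)] deg_cmp[OF assms(2)] assms(3) by simp_all
  then have "deg \<Lambda> \<beta> = deg \<Lambda> \<beta>'"
    using assms(4) by (metis add_left_cancel)
  then have "(\<alpha>, \<beta>) = (\<alpha>', \<beta>')"
    using unique_factorization[OF cmp_in_Mor[OF assms(1)] deg_in_nat_vecs[OF Mor(1)]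
        deg_in_nat_vecs[OF Mor(2)] deg1] assms
    by (metis fst_conv snd_conv)
  then show ?thesis by simp
qed

lemma factorization_exists:
  assumes "\<kappa> \<in> Mor \<Lambda>" "p \<le> deg \<Lambda> \<kappa>"
  obtains \<alpha> \<beta> where "(\<alpha>, \<beta>) \<in> composable \<Lambda>" "\<kappa> = cmp \<Lambda> \<alpha> \<beta>" "deg \<Lambda> \<alpha> = p"
    "deg \<Lambda> \<beta> = deg \<Lambda> \<kappa> - p"
proof -
  have "p \<in> nat_vecs k" "deg \<Lambda> \<kappa> - p \<in> nat_vecs k"
    using assms deg_in_nat_vecs nat_vecs_mono diff_in_nat_vecs by blast+
  from unique_factorization[OF assms(1) this] assms(2) that show thesis
    by (metis add_diff_vec prod.collapse)
qed

text \<open>Both r(\<kappa>)\<kappa> and \<kappa>s(\<kappa>) factor \<kappa> with a first factor of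
  degree 0, so uniqueness gives r(\<kappa>) = \<kappa>.\<close>

lemma deg_0_imp_Obj:
  assumes "\<kappa> \<in> Mor \<Lambda>" "deg \<Lambda> \<kappa> = 0"
  shows "\<kappa> \<in> Obj \<Lambda>"
proof -
  have "rng \<Lambda> \<kappa> = \<kappa>"
    using factorization_unique[OF composable_rng composable_src] assms
    by (simp add: cmp_rng cmp_src deg_Obj rng_in_Obj)
  then show ?thesis
    using rng_in_Obj[OF assms(1)] by simp
qed

text \<open>Unique factorization is used twice: cutting at degree \<open>p\<close> identifies the
  products \<open>cmp \<Lambda> \<beta> \<gamma>\<close>, and cutting these at the degree of \<beta>
  identifies \<beta> itself. This is the rule by which every factor below is computed.\<close>

lemma factor_eq:
  assumes "(\<alpha>, \<beta>) \<in> composable \<Lambda>" "(\<beta>, \<gamma>) \<in> composable \<Lambda>" "\<kappa> = cmp \<Lambda> \<alpha> (cmp \<Lambda> \<beta> \<gamma>)"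
    "deg \<Lambda> \<alpha> = p" "p + deg \<Lambda> \<beta> = q"
  shows "factor \<Lambda> \<kappa> p q = \<beta>"
  unfolding factor_def
proof (rule the_equality)
  show "is_factor \<Lambda> \<kappa> p q \<beta>"
    using assms unfolding is_factor_def by blast
next
  fix \<beta>'
  assume "is_factor \<Lambda> \<kappa> p q \<beta>'"
  then obtain \<alpha>' \<gamma>' where *: "(\<alpha>', \<beta>') \<in> composable \<Lambda>" "(\<beta>', \<gamma>') \<in> composable \<Lambda>"
    "\<kappa> = cmp \<Lambda> \<alpha>' (cmp \<Lambda> \<beta>' \<gamma>')" "deg \<Lambda> \<alpha>' = p" "p + deg \<Lambda> \<beta>' = q"
    unfolding is_factor_def by blast
  have "cmp \<Lambda> \<beta> \<gamma> = cmp \<Lambda> \<beta>' \<gamma>'"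
    using factorization_unique[OF composable_cmp_right[OF assms(1,2)]
        composable_cmp_right[OF *(1,2)]] assms(3,4) *(3,4) by simp
  moreover have "deg \<Lambda> \<beta> = deg \<Lambda> \<beta>'"
    using assms(5) *(5) by (metis add_left_cancel)
  ultimately show "\<beta>' = \<beta>"
    using factorization_unique[OF assms(2) *(2)] by simp
qed

text \<open>Cutting successively at \<open>t\<close>, \<open>q\<close> and \<open>p\<close> writes
  \<kappa> as a product of four morphisms \<alpha>, \<beta>, \<gamma>, \<delta>. The three factors
  in question are \<beta>, \<gamma> and their product, each recognised after reassociating.\<close>

lemma factor_split:
  assumes "\<kappa> \<in> Mor \<Lambda>" "p \<le> q" "q \<le> t" "t \<le> deg \<Lambda> \<kappa>"
  shows "(factor \<Lambda> \<kappa> p q, factor \<Lambda> \<kappa> q t) \<in> composable \<Lambda>"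
    and "factor \<Lambda> \<kappa> p t = cmp \<Lambda> (factor \<Lambda> \<kappa> p q) (factor \<Lambda> \<kappa> q t)"
    and "deg \<Lambda> (factor \<Lambda> \<kappa> p q) = q - p"
proof -
  obtain \<nu> \<delta> where 1: "(\<nu>, \<delta>) \<in> composable \<Lambda>" "\<kappa> = cmp \<Lambda> \<nu> \<delta>" "deg \<Lambda> \<nu> = t"
    using factorization_exists[OF assms(1,4)] by metis
  have "\<nu> \<in> Mor \<Lambda>" "q \<le> deg \<Lambda> \<nu>"
    using 1 assms(3) by (auto simp: composable_def)
  then obtain \<xi> \<gamma> where 2: "(\<xi>, \<gamma>) \<in> composable \<Lambda>" "\<nu> = cmp \<Lambda> \<xi> \<gamma>" "deg \<Lambda> \<xi> = q"
    "deg \<Lambda> \<gamma> = t - q"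
    using factorization_exists 1(3) by metis
  have "\<xi> \<in> Mor \<Lambda>" "p \<le> deg \<Lambda> \<xi>"
    using 2 assms(2) by (auto simp: composable_def)
  then obtain \<alpha> \<beta> where 3: "(\<alpha>, \<beta>) \<in> composable \<Lambda>" "\<xi> = cmp \<Lambda> \<alpha> \<beta>" "deg \<Lambda> \<alpha> = p"
    "deg \<Lambda> \<beta> = q - p"
    using factorization_exists 2(3) by metis
  have \<gamma>\<delta>: "(\<gamma>, \<delta>) \<in> composable \<Lambda>"
    using 1(1) 2(1,2) src_cmp[OF 2(1)] by (auto simp: composable_def)
  have \<beta>\<gamma>: "(\<beta>, \<gamma>) \<in> composable \<Lambda>"
    using 2(1) 3(1,2) src_cmp[OF 3(1)] by (auto simp: composable_def)
  have \<kappa>1: "\<kappa> = cmp \<Lambda> \<xi> (cmp \<Lambda> \<gamma> \<delta>)"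
    using 1(2) 2(2) cmp_assoc[OF 2(1) \<gamma>\<delta>] by simp
  have \<kappa>2: "\<kappa> = cmp \<Lambda> \<alpha> (cmp \<Lambda> \<beta> (cmp \<Lambda> \<gamma> \<delta>))"
    using \<kappa>1 3(2) cmp_assoc[OF 3(1) composable_cmp_right[OF \<beta>\<gamma> \<gamma>\<delta>]] by simp
  have pq: "p + (q - p) = q" and qt: "q + (t - q) = t"
    using assms add_diff_vec by auto
  have "deg \<Lambda> (cmp \<Lambda> \<beta> \<gamma>) = (q - p) + (t - q)"
    using deg_cmp[OF \<beta>\<gamma>] 2 3 by simp
  then have pt: "p + deg \<Lambda> (cmp \<Lambda> \<beta> \<gamma>) = t"
    using pq qt by (metis add.assoc)
  have "factor \<Lambda> \<kappa> p q = \<beta>"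
    using factor_eq[OF 3(1) composable_cmp_right[OF \<beta>\<gamma> \<gamma>\<delta>] \<kappa>2 3(3)] 3(4) pq by simp
  moreover have "factor \<Lambda> \<kappa> q t = \<gamma>"
    using factor_eq[OF 2(1) \<gamma>\<delta> \<kappa>1 2(3)] 2(4) qt by simp
  moreover have "factor \<Lambda> \<kappa> p t = cmp \<Lambda> \<beta> \<gamma>"
    using factor_eq[OF composable_cmp_right[OF 3(1) \<beta>\<gamma>] composable_cmp_left[OF \<beta>\<gamma> \<gamma>\<delta>] _ 3(3) pt]
      \<kappa>2 cmp_assoc[OF \<beta>\<gamma> \<gamma>\<delta>] by simp
  ultimately show "(factor \<Lambda> \<kappa> p q, factor \<Lambda> \<kappa> q t) \<in> composable \<Lambda>"
    "factor \<Lambda> \<kappa> p t = cmp \<Lambda> (factor \<Lambda> \<kappa> p q) (factor \<Lambda> \<kappa> q t)"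
    "deg \<Lambda> (factor \<Lambda> \<kappa> p q) = q - p"
    using \<beta>\<gamma> 3(4) by auto
qed

lemma factor_in_Mor:
  assumes "\<kappa> \<in> Mor \<Lambda>" "p \<le> q" "q \<le> deg \<Lambda> \<kappa>"
  shows "factor \<Lambda> \<kappa> p q \<in> Mor \<Lambda>"
  using factor_split(1)[OF assms(1,2) order_refl assms(3)] by (auto simp: composable_def)

lemma factor_refl_in_Obj:
  assumes "\<kappa> \<in> Mor \<Lambda>" "p \<le> deg \<Lambda> \<kappa>"
  shows "factor \<Lambda> \<kappa> p p \<in> Obj \<Lambda>"
  using factor_in_Mor[OF assms(1) order_refl assms(2)]
    factor_split(3)[OF assms(1) order_refl order_refl assms(2)]
  by (intro deg_0_imp_Obj) (auto simp: fun_eq_iff)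

text \<open>The factor from \<open>p\<close> to \<open>q\<close> is composable with the degenerate
  factor at \<open>p\<close>, which is an object and hence its own source.\<close>

lemma rng_factor:
  assumes "\<kappa> \<in> Mor \<Lambda>" "p \<le> q" "q \<le> deg \<Lambda> \<kappa>"
  shows "rng \<Lambda> (factor \<Lambda> \<kappa> p q) = factor \<Lambda> \<kappa> p p"
  using factor_split(1)[OF assms(1) order_refl assms(2,3)]
    src_Obj[OF factor_refl_in_Obj[OF assms(1) order_trans[OF assms(2,3)]]]
  by (auto simp: composable_def)

lemma src_factor:
  assumes "\<kappa> \<in> Mor \<Lambda>" "p \<le> q" "q \<le> deg \<Lambda> \<kappa>"
  shows "src \<Lambda> (factor \<Lambda> \<kappa> p q) = factor \<Lambda> \<kappa> q q"
  using factor_split(1)[OF assms(1,2) order_refl assms(3)]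
    rng_Obj[OF factor_refl_in_Obj[OF assms(1,3)]]
  by (auto simp: composable_def)

text \<open>An extension on the right is absorbed into the last of the three factors. Hence a
  segment can be read off any sufficiently long initial piece of a path, with the same
  result.\<close>

lemma factor_cmp:
  assumes "(\<kappa>, \<mu>) \<in> composable \<Lambda>" "p \<le> q" "q \<le> deg \<Lambda> \<kappa>"
  shows "factor \<Lambda> (cmp \<Lambda> \<kappa> \<mu>) p q = factor \<Lambda> \<kappa> p q"
proof -
  have "\<kappa> \<in> Mor \<Lambda>"
    using assms(1) by (auto simp: composable_def)
  then obtain \<xi> \<gamma> where 1: "(\<xi>, \<gamma>) \<in> composable \<Lambda>" "\<kappa> = cmp \<Lambda> \<xi> \<gamma>" "deg \<Lambda> \<xi> = q"
    using factorization_exists assms(3) by metis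
  have "\<xi> \<in> Mor \<Lambda>" "p \<le> deg \<Lambda> \<xi>"
    using 1 assms(2) by (auto simp: composable_def)
  then obtain \<alpha> \<beta> where 2: "(\<alpha>, \<beta>) \<in> composable \<Lambda>" "\<xi> = cmp \<Lambda> \<alpha> \<beta>" "deg \<Lambda> \<alpha> = p"
    "deg \<Lambda> \<beta> = q - p"
    using factorization_exists 1(3) by metis
  have \<gamma>\<mu>: "(\<gamma>, \<mu>) \<in> composable \<Lambda>"
    using assms(1) 1 src_cmp[OF 1(1)] by (auto simp: composable_def)
  have \<beta>\<gamma>: "(\<beta>, \<gamma>) \<in> composable \<Lambda>"
    using 1(1) 2(1,2) src_cmp[OF 2(1)] by (auto simp: composable_def)
  have pq: "p + deg \<Lambda> \<beta> = q"
    using 2(4) add_diff_vec[OF assms(2)] by simp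
  have "\<kappa> = cmp \<Lambda> \<alpha> (cmp \<Lambda> \<beta> \<gamma>)"
    using 1(2) 2(2) cmp_assoc[OF 2(1) \<beta>\<gamma>] by simp
  moreover from this have "cmp \<Lambda> \<kappa> \<mu> = cmp \<Lambda> \<alpha> (cmp \<Lambda> \<beta> (cmp \<Lambda> \<gamma> \<mu>))"
    using cmp_assoc[OF composable_cmp_right[OF 2(1) \<beta>\<gamma>] composable_cmp_left[OF \<beta>\<gamma> \<gamma>\<mu>]]
      cmp_assoc[OF \<beta>\<gamma> \<gamma>\<mu>] by simp
  ultimately show ?thesis
    using factor_eq[OF 2(1) \<beta>\<gamma> _ 2(3) pq]
      factor_eq[OF 2(1) composable_cmp_right[OF \<beta>\<gamma> \<gamma>\<mu>] _ 2(3) pq] by simp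
qed

section \<open>Paths\<close>

lemma Mor_Omega:
  "Mor (Omega k m) = {(p, q). p \<in> nat_vecs k \<and> q \<in> nat_vecs k \<and> p \<le> q \<and> enat_vec q \<le> m}"
  by (simp add: Omega_def)

lemma pathD:
  assumes "x \<in> paths k \<Lambda>" "q \<in> nat_vecs k" "p \<le> q" "enat_vec q \<le> path_deg x"
  shows "segment x p q \<in> Mor \<Lambda>" "rng \<Lambda> (segment x p q) = vertex x p"
    "src \<Lambda> (segment x p q) = vertex x q" "deg \<Lambda> (segment x p q) = q - p"
proof -
  have pq: "(p, q) \<in> Mor (Omega k (path_deg x))"
    using assms nat_vecs_mono by (auto simp: Mor_Omega)
  have F: "degree_functor (Omega k (path_deg x)) \<Lambda> (snd x)"
    using assms(1) by (auto simp: paths_def)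
  then show "segment x p q \<in> Mor \<Lambda>"
    using pq by (auto simp: degree_functor_def continuous_map_def)
  show "rng \<Lambda> (segment x p q) = vertex x p" "src \<Lambda> (segment x p q) = vertex x q"
    "deg \<Lambda> (segment x p q) = q - p"
    using F pq by (auto simp: degree_functor_def Omega_def)
qed

lemma path_cmp:
  assumes "x \<in> paths k \<Lambda>" "t \<in> nat_vecs k" "p \<le> q" "q \<le> t" "enat_vec t \<le> path_deg x"
  shows "segment x p t = cmp \<Lambda> (segment x p q) (segment x q t)"
    and "(segment x p q, segment x q t) \<in> composable \<Lambda>"
proof -
  have q: "q \<in> nat_vecs k" and p: "p \<in> nat_vecs k"
    using assms(2,3,4) nat_vecs_mono by blast+
  have qd: "enat_vec q \<le> path_deg x"
    using enat_vec_mono[OF assms(4,5)] .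
  have "((p, q), (q, t)) \<in> composable (Omega k (path_deg x))"
    using assms p q qd by (auto simp: composable_def Omega_def)
  moreover have F: "degree_functor (Omega k (path_deg x)) \<Lambda> (snd x)"
    using assms(1) by (auto simp: paths_def)
  ultimately have "snd x (cmp (Omega k (path_deg x)) (p, q) (q, t))
      = cmp \<Lambda> (segment x p q) (segment x q t)"
    unfolding degree_functor_def by blast
  then show "segment x p t = cmp \<Lambda> (segment x p q) (segment x q t)"
    by (simp add: Omega_def)
  show "(segment x p q, segment x q t) \<in> composable \<Lambda>"
    using pathD[OF assms(1) q assms(3) qd] pathD[OF assms(1,2,4,5)]
    by (auto simp: composable_def)
qed

text \<open>Continuity is automatic because \<open>Omega\<close> carries discrete topologies; only
  the algebraic laws remain as hypotheses.\<close>

lemma pathI: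
  assumes "m \<in> enat_vecs k" "x \<in> extensional (Mor (Omega k m))"
    and seg: "\<And>p q. q \<in> nat_vecs k \<Longrightarrow> p \<le> q \<Longrightarrow> enat_vec q \<le> m \<Longrightarrow>
      x (p, q) \<in> Mor \<Lambda> \<and> rng \<Lambda> (x (p, q)) = x (p, p) \<and> src \<Lambda> (x (p, q)) = x (q, q) \<and>
      deg \<Lambda> (x (p, q)) = q - p"
    and cmp: "\<And>p q t. t \<in> nat_vecs k \<Longrightarrow> p \<le> q \<Longrightarrow> q \<le> t \<Longrightarrow> enat_vec t \<le> m \<Longrightarrow>
      x (p, t) = cmp \<Lambda> (x (p, q)) (x (q, t))"
  shows "(m, x) \<in> paths k \<Lambda>"
proof -
  \<comment> \<open>The range law at \<open>q = p\<close> makes \<open>x (p, p)\<close> its own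
    range, hence an object.\<close>
  have "x (p, p) \<in> Obj \<Lambda>" if "p \<in> nat_vecs k" "enat_vec p \<le> m" for p
    using seg[OF that(1) order_refl that(2)] rng_in_Obj by metis
  then have "continuous_map (obj (Omega k m)) (obj \<Lambda>) x"
    by (auto simp: Omega_def)
  moreover have "continuous_map (mor (Omega k m)) (mor \<Lambda>) x"
    using seg by (auto simp: Omega_def)
  moreover have "\<forall>\<kappa> \<in> Mor (Omega k m). rng \<Lambda> (x \<kappa>) = x (rng (Omega k m) \<kappa>) \<and>
      src \<Lambda> (x \<kappa>) = x (src (Omega k m) \<kappa>) \<and> deg \<Lambda> (x \<kappa>) = deg (Omega k m) \<kappa>"
    using seg by (auto simp: Omega_def)
  moreover have "\<forall>(\<kappa>, \<mu>) \<in> composable (Omega k m).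
      x (cmp (Omega k m) \<kappa> \<mu>) = cmp \<Lambda> (x \<kappa>) (x \<mu>)"
  proof clarify
    fix p q q' t
    assume "((p, q), (q', t)) \<in> composable (Omega k m)"
    then have "q' = q" "t \<in> nat_vecs k" "p \<le> q" "q \<le> t" "enat_vec t \<le> m"
      by (auto simp: composable_def Omega_def)
    then show "x (cmp (Omega k m) (p, q) (q', t)) = cmp \<Lambda> (x (p, q)) (x (q', t))"
      using cmp[of t p q] by (simp only: Omega_def graph_data.simps prod.case)
  qed
  ultimately have "degree_functor (Omega k m) \<Lambda> x"
    unfolding degree_functor_def by blast
  then show ?thesis
    using assms(1,2) by (simp add: paths_def)
qed

text \<open>A path is thus determined by its initial segments, which reduces the uniqueness of
  \<kappa>x to a statement about morphisms starting at 0.\<close>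

lemma segment_eq_factor:
  assumes "x \<in> paths k \<Lambda>" "t \<in> nat_vecs k" "p \<le> q" "q \<le> t" "enat_vec t \<le> path_deg x"
  shows "segment x p q = factor \<Lambda> (segment x 0 t) p q"
proof (rule sym, rule factor_eq)
  have q: "q \<in> nat_vecs k" and p: "p \<in> nat_vecs k"
    using assms(2,3,4) nat_vecs_mono by blast+
  have qd: "enat_vec q \<le> path_deg x"
    using enat_vec_mono[OF assms(4,5)] .
  have pt: "p \<le> t" using assms(3,4) by (rule order_trans)
  show "(segment x 0 p, segment x p q) \<in> composable \<Lambda>"
    using path_cmp(2)[OF assms(1) q zero_le_vec assms(3) qd] .
  show "(segment x p q, segment x q t) \<in> composable \<Lambda>"
    using path_cmp(2)[OF assms] .
  show "segment x 0 t = cmp \<Lambda> (segment x 0 p) (cmp \<Lambda> (segment x p q) (segment x q t))"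
    using path_cmp(1)[OF assms(1,2) zero_le_vec pt assms(5)] path_cmp(1)[OF assms] by simp
  show "deg \<Lambda> (segment x 0 p) = p"
    using pathD(4)[OF assms(1) p zero_le_vec enat_vec_mono[OF pt assms(5)]]
    by (simp add: fun_eq_iff)
  show "p + deg \<Lambda> (segment x p q) = q"
    using pathD(4)[OF assms(1) q assms(3) qd] add_diff_vec[OF assms(3)] by simp
qed

text \<open>
  \<open>\<kappa>x\<close> restricted to \<open>(p, q)\<close> is read off the finite initial piece \<open>\<kappa>x(0, q - d(\<kappa>))\<close>, where the
  subtraction truncates coordinatewise.
\<close>

definition concat_path :: "'a \<Rightarrow> 'a path \<Rightarrow> 'a path" where
  "concat_path \<kappa> x = (enat_vec (deg \<Lambda> \<kappa>) + path_deg x,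
    restrict (\<lambda>(p, q). factor \<Lambda> (cmp \<Lambda> \<kappa> (segment x 0 (q - deg \<Lambda> \<kappa>))) p q)
      (Mor (Omega k (enat_vec (deg \<Lambda> \<kappa>) + path_deg x))))"

lemma path_deg_concat_path: "path_deg (concat_path \<kappa> x) = enat_vec (deg \<Lambda> \<kappa>) + path_deg x"
  by (simp add: concat_path_def)

section \<open>Existence and uniqueness of the concatenated path \<kappa>x\<close>

context
  fixes \<kappa> :: 'a and x :: "'a path"
  assumes \<kappa>: "\<kappa> \<in> Mor \<Lambda>" and x: "x \<in> paths k \<Lambda>" and src_\<kappa>: "src \<Lambda> \<kappa> = vertex x 0"
begin

lemma cmp_initial:
  assumes "t \<in> nat_vecs k" "enat_vec t \<le> path_deg x"
  shows "(\<kappa>, segment x 0 t) \<in> composable \<Lambda>" "cmp \<Lambda> \<kappa> (segment x 0 t) \<in> Mor \<Lambda>"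
    "deg \<Lambda> (cmp \<Lambda> \<kappa> (segment x 0 t)) = deg \<Lambda> \<kappa> + t"
proof -
  note D = pathD[OF x assms(1) zero_le_vec assms(2)]
  show c: "(\<kappa>, segment x 0 t) \<in> composable \<Lambda>"
    using D \<kappa> src_\<kappa> by (auto simp: composable_def)
  show "cmp \<Lambda> \<kappa> (segment x 0 t) \<in> Mor \<Lambda>"
    using c by (rule cmp_in_Mor)
  show "deg \<Lambda> (cmp \<Lambda> \<kappa> (segment x 0 t)) = deg \<Lambda> \<kappa> + t"
    using deg_cmp[OF c] D(4) by (simp add: fun_eq_iff)
qed

text \<open>The definition reads the segment off the piece belonging to \<open>q\<close>; any later
  \<open>t\<close> gives the same value. Several segments can therefore be compared inside a single
  morphism.\<close>

lemma segment_concat_path: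
  assumes t: "t \<in> nat_vecs k" "enat_vec t \<le> enat_vec (deg \<Lambda> \<kappa>) + path_deg x"
    and pq: "p \<le> q" "q \<le> t"
  shows "segment (concat_path \<kappa> x) p q
    = factor \<Lambda> (cmp \<Lambda> \<kappa> (segment x 0 (t - deg \<Lambda> \<kappa>))) p q"
proof -
  let ?r = "q - deg \<Lambda> \<kappa>" and ?s = "t - deg \<Lambda> \<kappa>"
  have q: "q \<in> nat_vecs k" "p \<in> nat_vecs k"
    using t pq nat_vecs_mono by blast+
  have qd: "enat_vec q \<le> enat_vec (deg \<Lambda> \<kappa>) + path_deg x"
    using enat_vec_mono[OF pq(2) t(2)] .
  have r: "?r \<in> nat_vecs k" "enat_vec ?r \<le> path_deg x"
    using q(1) qd by (simp_all add: diff_in_nat_vecs enat_vec_diff_le)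
  have s: "?s \<in> nat_vecs k" "enat_vec ?s \<le> path_deg x"
    using t by (simp_all add: diff_in_nat_vecs enat_vec_diff_le)
  have rs: "?r \<le> ?s"
    using pq(2) by (rule diff_mono_vec)
  note C = path_cmp[OF x s(1) zero_le_vec rs s(2)]
  \<comment> \<open>The longer piece is the shorter one extended on the right, the situation of
    \<open>factor_cmp\<close>.\<close>
  have "cmp \<Lambda> \<kappa> (segment x 0 ?s) = cmp \<Lambda> (cmp \<Lambda> \<kappa> (segment x 0 ?r)) (segment x ?r ?s)"
    using C(1) cmp_assoc[OF cmp_initial(1)[OF r] C(2)] by simp
  \<comment> \<open>Because of truncation this degree is the coordinatewise maximum of
    \<open>q\<close> and \<open>deg \<Lambda> \<kappa>\<close>: it dominates \<open>q\<close> but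
    may differ from it.\<close>
  moreover have "q \<le> deg \<Lambda> (cmp \<Lambda> \<kappa> (segment x 0 ?r))"
    using cmp_initial(3)[OF r] le_add_diff_vec by simp
  ultimately have "factor \<Lambda> (cmp \<Lambda> \<kappa> (segment x 0 ?s)) p q
      = factor \<Lambda> (cmp \<Lambda> \<kappa> (segment x 0 ?r)) p q"
    using factor_cmp[OF composable_cmp_left[OF cmp_initial(1)[OF r] C(2)] pq(1)] by simp
  moreover have "(p, q) \<in> Mor (Omega k (enat_vec (deg \<Lambda> \<kappa>) + path_deg x))"
    using q qd pq by (simp add: Mor_Omega)
  ultimately show ?thesis
    by (simp add: concat_path_def)
qed

text \<open>All segments in a given law are factors of one morphism, the piece belonging to the
  largest index involved, so the laws are those of \<open>factor_split\<close> and its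
  consequences.\<close>

lemma concat_path_in_paths: "concat_path \<kappa> x \<in> paths k \<Lambda>"
proof -
  let ?m = "enat_vec (deg \<Lambda> \<kappa>) + path_deg x"
  let ?y = "snd (concat_path \<kappa> x)"
  have "(?m, ?y) \<in> paths k \<Lambda>"
  proof (rule pathI)
    show "?m \<in> enat_vecs k"
    proof -
      have "path_deg x \<in> enat_vecs k"
        using x by (auto simp: paths_def)
      then show ?thesis
        using deg_in_nat_vecs[OF \<kappa>]
        by (simp add: enat_vecs_def nat_vecs_def enat_vec_def flip: zero_enat_def)
    qed
    show "?y \<in> extensional (Mor (Omega k ?m))"
      by (simp add: concat_path_def)
  next
    fix p q
    assume q: "q \<in> nat_vecs k" and pq: "p \<le> q" and qd: "enat_vec q \<le> ?m"
    let ?\<mu> = "cmp \<Lambda> \<kappa> (segment x 0 (q - deg \<Lambda> \<kappa>))"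
    have r: "q - deg \<Lambda> \<kappa> \<in> nat_vecs k" "enat_vec (q - deg \<Lambda> \<kappa>) \<le> path_deg x"
      using q qd by (simp_all add: diff_in_nat_vecs enat_vec_diff_le)
    have M: "?\<mu> \<in> Mor \<Lambda>" "q \<le> deg \<Lambda> ?\<mu>"
      using cmp_initial[OF r] le_add_diff_vec by auto
    note S = segment_concat_path[OF q qd]
    show "?y (p, q) \<in> Mor \<Lambda> \<and> rng \<Lambda> (?y (p, q)) = ?y (p, p) \<and> src \<Lambda> (?y (p, q)) = ?y (q, q)
        \<and> deg \<Lambda> (?y (p, q)) = q - p"
      using S[OF pq order_refl] S[OF order_refl pq] S[OF order_refl order_refl]
        factor_in_Mor[OF M(1) pq M(2)] rng_factor[OF M(1) pq M(2)] src_factor[OF M(1) pq M(2)]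
        factor_split(3)[OF M(1) pq order_refl M(2)]
      by simp
  next
    fix p q t
    assume t: "t \<in> nat_vecs k" and pq: "p \<le> q" and qt: "q \<le> t" and td: "enat_vec t \<le> ?m"
    let ?\<mu> = "cmp \<Lambda> \<kappa> (segment x 0 (t - deg \<Lambda> \<kappa>))"
    have r: "t - deg \<Lambda> \<kappa> \<in> nat_vecs k" "enat_vec (t - deg \<Lambda> \<kappa>) \<le> path_deg x"
      using t td by (simp_all add: diff_in_nat_vecs enat_vec_diff_le)
    have M: "?\<mu> \<in> Mor \<Lambda>" "t \<le> deg \<Lambda> ?\<mu>"
      using cmp_initial[OF r] le_add_diff_vec by auto
    note S = segment_concat_path[OF t td]
    show "?y (p, t) = cmp \<Lambda> (?y (p, q)) (?y (q, t))"
      using S[OF pq qt] S[OF qt order_refl] S[OF order_trans[OF pq qt] order_refl]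
        factor_split(2)[OF M(1) pq qt M(2)]
      by simp
  qed
  then show ?thesis
    by (simp add: concat_path_def)
qed

lemma segment_concat_path_left: "segment (concat_path \<kappa> x) 0 (deg \<Lambda> \<kappa>) = \<kappa>"
proof -
  let ?n = "deg \<Lambda> \<kappa>"
  have n: "?n \<in> nat_vecs k" "enat_vec ?n \<le> enat_vec ?n + path_deg x"
    using deg_in_nat_vecs[OF \<kappa>] enat_vec_add_le[of 0 "path_deg x" ?n] by simp_all
  have z: "?n - ?n = 0"
    by (simp add: fun_eq_iff)
  have "cmp \<Lambda> \<kappa> (vertex x 0) = \<kappa>"
    using cmp_src[OF \<kappa>] src_\<kappa> by simp
  then have "segment (concat_path \<kappa> x) 0 ?n = factor \<Lambda> \<kappa> 0 ?n"
    using segment_concat_path[OF n zero_le_vec order_refl] z by simp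
  \<comment> \<open>Here \<kappa> is the middle factor of r(\<kappa>)\<kappa>s(\<kappa>), whose
    outer factors have degree 0.\<close>
  also have "\<dots> = \<kappa>"
    using composable_rng[OF \<kappa>] composable_src[OF \<kappa>] \<kappa>
    by (intro factor_eq) (auto simp: cmp_rng cmp_src deg_Obj rng_in_Obj)
  finally show ?thesis .
qed

lemma segment_concat_path_right:
  assumes p: "p \<in> nat_vecs k" "enat_vec p \<le> path_deg x"
  shows "segment (concat_path \<kappa> x) (deg \<Lambda> \<kappa>) (deg \<Lambda> \<kappa> + p) = segment x 0 p"
proof -
  let ?n = "deg \<Lambda> \<kappa>"
  note D = pathD[OF x p(1) zero_le_vec p(2)]
  have "segment (concat_path \<kappa> x) ?n (?n + p) = factor \<Lambda> (cmp \<Lambda> \<kappa> (segment x 0 p)) ?n (?n + p)"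
    using segment_concat_path[OF add_in_nat_vecs[OF deg_in_nat_vecs[OF \<kappa>] p(1)]
        enat_vec_add_le[OF p(2)] le_add_vec order_refl] by simp
  \<comment> \<open>The segment is the middle factor between \<kappa> and its own source.\<close>
  also have "\<dots> = segment x 0 p"
    using cmp_initial(1)[OF p] composable_src[OF D(1)] D(1,4)
    by (intro factor_eq) (auto simp: cmp_src fun_eq_iff)
  finally show ?thesis .
qed

text \<open>The two conditions force the initial segment of \<open>y\<close> up to
  \<open>n + (q - n)\<close>, with \<open>n\<close> the degree of \<kappa>, to be \<kappa> followed
  by an initial segment of \<open>x\<close>. This index dominates \<open>q\<close>, so
  \<open>segment y p q\<close> is a factor of that morphism.\<close>

lemma path_eq_concat_path:
  assumes y: "y \<in> paths k \<Lambda>" "path_deg y = enat_vec (deg \<Lambda> \<kappa>) + path_deg x"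
    and left: "segment y 0 (deg \<Lambda> \<kappa>) = \<kappa>"
    and right: "\<And>p. p \<in> nat_vecs k \<Longrightarrow> enat_vec p \<le> path_deg x \<Longrightarrow>
      segment y (deg \<Lambda> \<kappa>) (deg \<Lambda> \<kappa> + p) = segment x 0 p"
  shows "y = concat_path \<kappa> x"
proof (rule prod_eqI)
  let ?n = "deg \<Lambda> \<kappa>"
  show "path_deg y = path_deg (concat_path \<kappa> x)"
    using y(2) by (simp add: path_deg_concat_path)
  show "snd y = snd (concat_path \<kappa> x)"
  proof (rule extensionalityI)
    show "snd y \<in> extensional (Mor (Omega k (path_deg y)))"
      using y(1) by (auto simp: paths_def)
    show "snd (concat_path \<kappa> x) \<in> extensional (Mor (Omega k (path_deg y)))"
      using y(2) by (simp add: concat_path_def)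
    fix z
    assume "z \<in> Mor (Omega k (path_deg y))"
    then obtain p q where z: "z = (p, q)" and q: "q \<in> nat_vecs k" and pq: "p \<le> q"
      and qd: "enat_vec q \<le> path_deg y"
      by (auto simp: Mor_Omega)
    let ?r = "q - ?n"
    have r: "?r \<in> nat_vecs k" "enat_vec ?r \<le> path_deg x"
      using q qd y(2) by (simp_all add: diff_in_nat_vecs enat_vec_diff_le)
    have t: "?n + ?r \<in> nat_vecs k" "enat_vec (?n + ?r) \<le> path_deg y"
      using add_in_nat_vecs[OF deg_in_nat_vecs[OF \<kappa>] r(1)] enat_vec_add_le[OF r(2)] y(2) by auto
    have "segment y 0 (?n + ?r) = cmp \<Lambda> \<kappa> (segment x 0 ?r)"
      using path_cmp(1)[OF y(1) t(1) zero_le_vec le_add_vec t(2)] left right[OF r] by simp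
    then have "segment y p q = factor \<Lambda> (cmp \<Lambda> \<kappa> (segment x 0 ?r)) p q"
      using segment_eq_factor[OF y(1) t(1) pq le_add_diff_vec t(2)] by simp
    then show "snd y z = snd (concat_path \<kappa> x) z"
      using segment_concat_path[OF q _ pq order_refl] qd y(2) z by simp
  qed
qed

text \<open>Existence and uniqueness together discharge the definite description, which is replaced
  by an explicit path.\<close>

lemma path_cons_eq_concat_path: "path_cons k \<Lambda> \<kappa> x = concat_path \<kappa> x"
  unfolding path_cons_def
proof (rule the_equality)
  show "concat_path \<kappa> x \<in> paths k \<Lambda> \<and>
    path_deg (concat_path \<kappa> x) = enat_vec (deg \<Lambda> \<kappa>) + path_deg x \<and>
    segment (concat_path \<kappa> x) 0 (deg \<Lambda> \<kappa>) = \<kappa> \<and>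
    (\<forall>p \<in> nat_vecs k. enat_vec p \<le> path_deg x \<longrightarrow>
      segment (concat_path \<kappa> x) (deg \<Lambda> \<kappa>) (deg \<Lambda> \<kappa> + p) = segment x 0 p)"
    using concat_path_in_paths segment_concat_path_left segment_concat_path_right
      path_deg_concat_path by blast
qed (elim conjE, rule path_eq_concat_path, simp_all)

lemma path_cons_initial:
  "enat_vec (deg \<Lambda> \<kappa>) \<le> path_deg (path_cons k \<Lambda> \<kappa> x)"
  "segment (path_cons k \<Lambda> \<kappa> x) 0 (deg \<Lambda> \<kappa>) = \<kappa>"
  unfolding path_cons_eq_concat_path
  using enat_vec_add_le[of 0 "path_deg x" "deg \<Lambda> \<kappa>"]
  by (simp_all add: path_deg_concat_path segment_concat_path_left)

end

text \<open>The required \<open>x\<close> is the tail of \<open>y\<close> after \<open>n\<close>,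
  obtained by shifting both indices by \<open>n\<close>.\<close>

lemma path_eq_path_cons:
  assumes y: "y \<in> paths k \<Lambda>" and n: "n \<in> nat_vecs k" "enat_vec n \<le> path_deg y"
  obtains x where "x \<in> paths k \<Lambda>" "src \<Lambda> (segment y 0 n) = vertex x 0"
    "path_cons k \<Lambda> (segment y 0 n) x = y"
proof -
  let ?m = "path_deg y - enat_vec n"
  let ?f = "restrict (\<lambda>(p, q). segment y (n + p) (n + q)) (Mor (Omega k ?m))"
  have m: "enat_vec n + ?m = path_deg y"
    using n(2) by (rule enat_vec_add_diff)
  have le: "n + q \<in> nat_vecs k" "enat_vec (n + q) \<le> path_deg y"
    if "q \<in> nat_vecs k" "enat_vec q \<le> ?m" for q
    using add_in_nat_vecs[OF n(1) that(1)] enat_vec_add_le[OF that(2), of n] m by simp_all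
  have f: "?f (p, q) = segment y (n + p) (n + q)"
    if "q \<in> nat_vecs k" "p \<le> q" "enat_vec q \<le> ?m" for p q
    using that nat_vecs_mono[OF that(1,2)] by (simp add: Mor_Omega)
  have path: "(?m, ?f) \<in> paths k \<Lambda>"
  proof (rule pathI)
    show "?m \<in> enat_vecs k"
      using y by (auto simp: paths_def enat_vecs_def)
    show "?f \<in> extensional (Mor (Omega k ?m))"
      by simp
  next
    fix p q
    assume q: "q \<in> nat_vecs k" and pq: "p \<le> q" and qd: "enat_vec q \<le> ?m"
    show "?f (p, q) \<in> Mor \<Lambda> \<and> rng \<Lambda> (?f (p, q)) = ?f (p, p) \<and> src \<Lambda> (?f (p, q)) = ?f (q, q)
        \<and> deg \<Lambda> (?f (p, q)) = q - p"
      unfolding f[OF q pq qd] f[OF q order_refl qd]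
        f[OF nat_vecs_mono[OF q pq] order_refl enat_vec_mono[OF pq qd]]
      using pathD[OF y le(1)[OF q qd] add_mono_vec[OF pq] le(2)[OF q qd]]
      by (simp add: fun_eq_iff)
  next
    fix p q t
    assume t: "t \<in> nat_vecs k" and pq: "p \<le> q" and qt: "q \<le> t" and td: "enat_vec t \<le> ?m"
    show "?f (p, t) = cmp \<Lambda> (?f (p, q)) (?f (q, t))"
      unfolding f[OF t order_trans[OF pq qt] td] f[OF t qt td]
        f[OF nat_vecs_mono[OF t qt] pq enat_vec_mono[OF qt td]]
      using path_cmp(1)[OF y le(1)[OF t td] add_mono_vec[OF pq] add_mono_vec[OF qt] le(2)[OF t td]] .
  qed
  note D = pathD[OF y n(1) zero_le_vec n(2)]
  have deg: "deg \<Lambda> (segment y 0 n) = n"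
    using D(4) by (simp add: fun_eq_iff)
  have src: "src \<Lambda> (segment y 0 n) = vertex (?m, ?f) 0"
    using D(3) f[OF zero_in_nat_vecs order_refl enat_vec_zero_le] by simp
  \<comment> \<open>The path \<open>y\<close> itself meets the conditions that characterise the
    concatenation of its initial segment with its tail.\<close>
  have "path_cons k \<Lambda> (segment y 0 n) (?m, ?f) = y"
    unfolding path_cons_eq_concat_path[OF D(1) path src]
  proof (rule sym, rule path_eq_concat_path[OF D(1) path src y])
    show "path_deg y = enat_vec (deg \<Lambda> (segment y 0 n)) + path_deg (?m, ?f)"
      using m deg by simp
    show "segment y 0 (deg \<Lambda> (segment y 0 n)) = segment y 0 n"
      using deg by simp
    fix p
    assume "p \<in> nat_vecs k" "enat_vec p \<le> path_deg (?m, ?f)"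
    then show "segment y (deg \<Lambda> (segment y 0 n)) (deg \<Lambda> (segment y 0 n) + p)
        = segment (?m, ?f) 0 p"
      using f[of p 0] deg by simp
  qed
  then show thesis
    using that path src by blast
qed

section \<open>The path space topology\<close>

text \<open>Degree difference 0 makes both morphisms initial segments of \<open>y\<close> of the
  same degree, hence equal; so a unit sees only the diagonal part of \<open>F\<close>. Conversely,
  \<open>y\<close> is its initial segment followed by its tail.\<close>

lemma unit_in_cylinder_iff:
  assumes y: "y \<in> paths k \<Lambda>"
  shows "(y, 0, y) \<in> cylinder k \<Lambda> F 0 \<longleftrightarrow>
    (\<exists>\<kappa> \<in> Mor \<Lambda>. (\<kappa>, \<kappa>) \<in> F \<and> enat_vec (deg \<Lambda> \<kappa>) \<le> path_deg y \<and> segment y 0 (deg \<Lambda> \<kappa>) = \<kappa>)"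
    (is "_ \<longleftrightarrow> ?R")
proof
  assume "(y, 0, y) \<in> cylinder k \<Lambda> F 0"
  then obtain \<kappa> \<mu> x where *: "y = path_cons k \<Lambda> \<kappa> x" "y = path_cons k \<Lambda> \<mu> x" "(\<kappa>, \<mu>) \<in> F"
    "\<kappa> \<in> Mor \<Lambda>" "\<mu> \<in> Mor \<Lambda>" "x \<in> paths k \<Lambda>" "src \<Lambda> \<kappa> = vertex x 0" "src \<Lambda> \<mu> = vertex x 0"
    "deg_diff (deg \<Lambda> \<kappa>) (deg \<Lambda> \<mu>) = 0"
    unfolding cylinder_def by (simp del: split_paired_Ex) metis
  have "deg \<Lambda> \<kappa> = deg \<Lambda> \<mu>"
    using *(9) by (simp add: deg_diff_eq_0_iff)
  then have "\<kappa> = \<mu>"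
    using path_cons_initial(2)[OF *(4,6,7)] path_cons_initial(2)[OF *(5,6,8)] *(1,2) by metis
  then show ?R
    using path_cons_initial[OF *(4,6,7)] *(1,3,4) by auto
next
  assume ?R
  then obtain \<kappa> where \<kappa>: "\<kappa> \<in> Mor \<Lambda>" "(\<kappa>, \<kappa>) \<in> F" "enat_vec (deg \<Lambda> \<kappa>) \<le> path_deg y"
    "segment y 0 (deg \<Lambda> \<kappa>) = \<kappa>" by blast
  then obtain x where "x \<in> paths k \<Lambda>" "src \<Lambda> \<kappa> = vertex x 0" "path_cons k \<Lambda> \<kappa> x = y"
    using path_eq_path_cons[OF y deg_in_nat_vecs] by metis
  then show "(y, 0, y) \<in> cylinder k \<Lambda> F 0"
    using \<kappa> unfolding cylinder_def
    by (intro CollectI exI[of _ \<kappa>] exI[of _ x]) (simp add: deg_diff_eq_0_iff)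
qed

text \<open>This is the set Z(U) of paths with an initial segment in U, formed directly in the unit
  space.\<close>

definition path_cylinder :: "'a set \<Rightarrow> 'a path set" where
  "path_cylinder U = {x \<in> paths k \<Lambda>. \<exists>\<kappa> \<in> U \<inter> Mor \<Lambda>.
    enat_vec (deg \<Lambda> \<kappa>) \<le> path_deg x \<and> segment x 0 (deg \<Lambda> \<kappa>) = \<kappa>}"

text \<open>The set is the trace on the units of a basic open set of the groupoid: take both open
  sets equal to \<open>U\<close>, degree difference 0, and as compact set the diagonal copy of
  \<open>F\<close>.\<close>

lemma openin_path_cylinder_diff:
  assumes U: "openin (mor \<Lambda>) U" and F: "compactin (mor \<Lambda>) F"
  shows "openin (path_space k \<Lambda>) (path_cylinder U - path_cylinder F)"
proof -
  let ?D = "(\<lambda>\<kappa>. (\<kappa>, \<kappa>)) ` F"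
  let ?B = "cylinder k \<Lambda> (src_prod \<Lambda> U U) 0 \<inter> (path_groupoid k \<Lambda> - cylinder k \<Lambda> ?D 0)"
  have "F \<subseteq> Mor \<Lambda>"
    using F by (rule compactin_subset_topspace)
  moreover have "compactin (prod_topology (mor \<Lambda>) (mor \<Lambda>)) ?D"
    using F by (rule image_compactin) (simp add: continuous_map_pairedI)
  ultimately have D: "compactin
      (subtopology (prod_topology (mor \<Lambda>) (mor \<Lambda>)) (src_prod \<Lambda> (Mor \<Lambda>) (Mor \<Lambda>))) ?D"
    by (auto simp: compactin_subtopology src_prod_def)
  have "0 \<in> int_vecs k"
    by (simp add: int_vecs_def)
  then have "openin (path_groupoid_topology k \<Lambda>) ?B"
    unfolding path_groupoid_topology_def using U D
    by (intro topology_generated_by_Basis CollectI exI[of _ U] exI[of _ ?D]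
        exI[of _ "0 :: nat \<Rightarrow> int"]) auto
  moreover have "path_cylinder U - path_cylinder F = (\<lambda>x. (x, 0, x)) -` ?B \<inter> paths k \<Lambda>"
  proof (rule set_eqI)
    fix x
    \<comment> \<open>The basic set takes its complement inside the groupoid, so a unit in the first
      cylinder must be known to lie there.\<close>
    have *: "cylinder k \<Lambda> (src_prod \<Lambda> U U) 0 \<subseteq> path_groupoid k \<Lambda>"
      unfolding cylinder_def path_groupoid_def by blast
    show "x \<in> path_cylinder U - path_cylinder F \<longleftrightarrow> x \<in> (\<lambda>x. (x, 0, x)) -` ?B \<inter> paths k \<Lambda>"
    proof (cases "x \<in> paths k \<Lambda>")
      case True
      have "(\<kappa>, \<kappa>) \<in> src_prod \<Lambda> U U \<longleftrightarrow> \<kappa> \<in> U \<inter> Mor \<Lambda>" "(\<kappa>, \<kappa>) \<in> ?D \<longleftrightarrow> \<kappa> \<in> F" for \<kappa>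
        by (auto simp: src_prod_def)
      then have "(x, 0, x) \<in> cylinder k \<Lambda> (src_prod \<Lambda> U U) 0 \<longleftrightarrow> x \<in> path_cylinder U"
        "(x, 0, x) \<in> cylinder k \<Lambda> ?D 0 \<longleftrightarrow> x \<in> path_cylinder F"
        unfolding unit_in_cylinder_iff[OF True] path_cylinder_def using True by blast+
      then show ?thesis
        using * True by blast
    next
      case False
      then show ?thesis
        by (simp add: path_cylinder_def)
    qed
  qed
  ultimately show ?thesis
    unfolding path_space_def openin_pullback_topology by (intro exI[of _ ?B] conjI)
qed

text \<open>The space of a pullback topology consists only of points mapped into the generated
  space, so the units must be covered by basic sets. Every path lies in the cylinder over all
  morphisms, since its initial vertex is an initial segment of degree 0.\<close>

lemma topspace_path_space: "topspace (path_space k \<Lambda>) = paths k \<Lambda>"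
proof
  show "topspace (path_space k \<Lambda>) \<subseteq> paths k \<Lambda>"
    by (auto simp: path_space_def topspace_pullback_topology)
  have *: "x \<in> path_cylinder (Mor \<Lambda>) - path_cylinder {}" if "x \<in> paths k \<Lambda>" for x
  proof -
    have "vertex x 0 \<in> Mor \<Lambda>" "deg \<Lambda> (vertex x 0) = 0"
      using pathD[OF that zero_in_nat_vecs order_refl enat_vec_zero_le] by (auto simp: fun_eq_iff)
    then show ?thesis
      using that unfolding path_cylinder_def by (auto intro!: bexI[of _ "vertex x 0"])
  qed
  show "paths k \<Lambda> \<subseteq> topspace (path_space k \<Lambda>)"
    by (rule order_trans[OF subsetI[OF *]])
      (simp_all add: openin_subset[OF openin_path_cylinder_diff[OF openin_topspace compactin_empty]])
qed

section \<open>Products of compact sets, and cylinders over them\<close>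

lemma compactin_set_cmp:
  assumes K: "compactin (mor \<Lambda>) K" and E: "compactin (mor \<Lambda>) E"
  shows "compactin (mor \<Lambda>) (set_cmp \<Lambda> K E)"
proof -
  let ?P = "prod_topology (mor \<Lambda>) (mor \<Lambda>)"
  \<comment> \<open>Composable pairs are where two continuous maps into the Hausdorff object space
    agree. They form a closed set, so its part in the product of \<open>K\<close> and
    \<open>E\<close> is compact, and composition maps that part continuously onto
    \<open>set_cmp \<Lambda> K E\<close>.\<close>
  have "closedin ?P {z \<in> topspace ?P. src \<Lambda> (fst z) = rng \<Lambda> (snd z)}"
    using continuous_map_compose[OF continuous_map_fst continuous_src, of "mor \<Lambda>"]
      continuous_map_compose[OF continuous_map_snd continuous_rng, of "mor \<Lambda>"]
    by (intro closedin_continuous_maps_eq[OF Hausdorff_obj]) (auto simp: o_def)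
  moreover have "{z \<in> topspace ?P. src \<Lambda> (fst z) = rng \<Lambda> (snd z)} = composable \<Lambda>"
    by (auto simp: composable_def)
  ultimately have "compactin ?P (composable \<Lambda> \<inter> (K \<times> E))"
    using K E by (intro closed_Int_compactin) (auto simp: compactin_Times)
  then have "compactin (subtopology ?P (composable \<Lambda>)) (composable \<Lambda> \<inter> (K \<times> E))"
    by (simp add: compactin_subtopology)
  from image_compactin[OF this continuous_cmp]
  have "compactin (mor \<Lambda>) ((\<lambda>(\<kappa>, \<mu>). cmp \<Lambda> \<kappa> \<mu>) ` (composable \<Lambda> \<inter> (K \<times> E)))" .
  moreover have "(\<lambda>(\<kappa>, \<mu>). cmp \<Lambda> \<kappa> \<mu>) ` (composable \<Lambda> \<inter> (K \<times> E)) = set_cmp \<Lambda> K E"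
    unfolding set_cmp_def image_def Bex_def split_paired_Ex by auto
  ultimately show ?thesis
    by simp
qed

text \<open>All elements of \<open>K\<close> have degree \<open>m\<close>. By unique factorization
  an initial segment lying in KE therefore splits exactly at \<open>m\<close>, and its second factor
  is the segment of \<open>x\<close> starting there.\<close>

lemma segment_in_set_cmp_iff:
  assumes x: "x \<in> paths k \<Lambda>" and m: "m \<in> nat_vecs k" "enat_vec m \<le> path_deg x"
    and K: "segment x 0 m \<in> K" "\<And>\<kappa>. \<kappa> \<in> K \<Longrightarrow> deg \<Lambda> \<kappa> = m" and E: "E \<subseteq> Mor \<Lambda>"
  shows "x \<in> path_cylinder (set_cmp \<Lambda> K E) \<longleftrightarrow>
    (\<exists>\<mu> \<in> E. enat_vec (m + deg \<Lambda> \<mu>) \<le> path_deg x \<and> segment x m (m + deg \<Lambda> \<mu>) = \<mu>)"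
    (is "_ \<longleftrightarrow> ?R")
proof
  assume "x \<in> path_cylinder (set_cmp \<Lambda> K E)"
  then obtain \<kappa> \<mu> where \<kappa>\<mu>: "(\<kappa>, \<mu>) \<in> composable \<Lambda>" "\<kappa> \<in> K" "\<mu> \<in> E"
    "enat_vec (deg \<Lambda> (cmp \<Lambda> \<kappa> \<mu>)) \<le> path_deg x"
    "segment x 0 (deg \<Lambda> (cmp \<Lambda> \<kappa> \<mu>)) = cmp \<Lambda> \<kappa> \<mu>"
    unfolding path_cylinder_def set_cmp_def by auto
  have deg: "deg \<Lambda> (cmp \<Lambda> \<kappa> \<mu>) = m + deg \<Lambda> \<mu>"
    using deg_cmp \<kappa>\<mu>(1,2) K(2) by simp
  have "m + deg \<Lambda> \<mu> \<in> nat_vecs k"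
    using deg deg_in_nat_vecs[OF cmp_in_Mor[OF \<kappa>\<mu>(1)]] by simp
  note C = path_cmp[OF x this zero_le_vec le_add_vec \<kappa>\<mu>(4)[unfolded deg]]
  have "\<mu> = segment x m (m + deg \<Lambda> \<mu>)"
  proof -
    have "cmp \<Lambda> \<kappa> \<mu> = cmp \<Lambda> (segment x 0 m) (segment x m (m + deg \<Lambda> \<mu>))"
      using \<kappa>\<mu>(5) unfolding deg C(1) by (rule sym)
    moreover have "deg \<Lambda> \<kappa> = deg \<Lambda> (segment x 0 m)"
      using K(2)[OF \<kappa>\<mu>(2)] K(2)[OF K(1)] by (rule trans[OF _ sym])
    ultimately show ?thesis
      using factorization_unique[OF \<kappa>\<mu>(1) C(2)] by blast
  qed
  from this[symmetric] show ?R
    using \<kappa>\<mu>(3,4) unfolding deg by (intro bexI conjI)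
next
  assume ?R
  then obtain \<mu> where \<mu>: "\<mu> \<in> E" "enat_vec (m + deg \<Lambda> \<mu>) \<le> path_deg x"
    "segment x m (m + deg \<Lambda> \<mu>) = \<mu>" by blast
  have "m + deg \<Lambda> \<mu> \<in> nat_vecs k"
    using \<mu>(1) E m(1) deg_in_nat_vecs add_in_nat_vecs by blast
  note C = path_cmp[OF x this zero_le_vec le_add_vec \<mu>(2)]
  let ?\<nu> = "cmp \<Lambda> (segment x 0 m) \<mu>"
  have c: "(segment x 0 m, \<mu>) \<in> composable \<Lambda>"
    using C(2) \<mu>(3) by simp
  then have "?\<nu> \<in> set_cmp \<Lambda> K E" "?\<nu> \<in> Mor \<Lambda>" "deg \<Lambda> ?\<nu> = m + deg \<Lambda> \<mu>"
    using K \<mu>(1) cmp_in_Mor deg_cmp[OF c] by (auto simp: set_cmp_def)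
  moreover have "segment x 0 (m + deg \<Lambda> \<mu>) = ?\<nu>"
    using C(1) unfolding \<mu>(3) .
  ultimately show "x \<in> path_cylinder (set_cmp \<Lambda> K E)"
    using x \<mu>(2) unfolding path_cylinder_def by (intro CollectI conjI bexI[of _ ?\<nu>]) simp_all
qed

section \<open>Closedness of the set of boundary paths\<close>

lemma closedin_boundary_paths: "closedin (path_space k \<Lambda>) (boundary_paths k \<Lambda>)"
  unfolding closedin_def topspace_path_space
proof
  show "boundary_paths k \<Lambda> \<subseteq> paths k \<Lambda>"
    by (auto simp: boundary_paths_def)
  show "openin (path_space k \<Lambda>) (paths k \<Lambda> - boundary_paths k \<Lambda>)"
  proof (subst openin_subopen, rule ballI)
    fix x
    assume "x \<in> paths k \<Lambda> - boundary_paths k \<Lambda>"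
    then obtain m E where x: "x \<in> paths k \<Lambda>"
      and m: "m \<in> nat_vecs k" "enat_vec m \<le> path_deg x"
      and E: "E \<in> compact_exhaustive \<Lambda> (vertex x m)"
      and none: "\<not> (\<exists>\<mu> \<in> E. enat_vec (m + deg \<Lambda> \<mu>) \<le> path_deg x \<and>
        segment x m (m + deg \<Lambda> \<mu>) = \<mu>)"
      unfolding boundary_paths_def by blast
    from E obtain W where W: "openin (obj \<Lambda>) W" "vertex x m \<in> W" "W \<subseteq> rng \<Lambda> ` E"
      and cE: "compactin (mor \<Lambda>) E" and ex: "exhaustive \<Lambda> (rng \<Lambda> ` E) E"
      unfolding compact_exhaustive_def by blast
    have EM: "E \<subseteq> Mor \<Lambda>"
      using cE by (rule compactin_subset_topspace)
    \<comment> \<open>Fixing the degree is an open condition because degrees are discrete; fixing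
      the source in \<open>W\<close> is open because the source map is continuous.\<close>
    let ?N = "{\<kappa> \<in> Mor \<Lambda>. deg \<Lambda> \<kappa> \<in> {m}} \<inter> {\<kappa> \<in> Mor \<Lambda>. src \<Lambda> \<kappa> \<in> W}"
    have N: "openin (mor \<Lambda>) ?N"
      using openin_continuous_map_preimage[OF continuous_deg, of "{m}"]
        openin_continuous_map_preimage[OF continuous_src W(1)] m(1) by auto
    have xm: "segment x 0 m \<in> Mor \<Lambda>" "src \<Lambda> (segment x 0 m) = vertex x m"
      "deg \<Lambda> (segment x 0 m) = m"
      using pathD[OF x m(1) zero_le_vec m(2)] by (auto simp: fun_eq_iff)
    \<comment> \<open>In a locally compact Hausdorff space the compact neighbourhoods form a
      neighbourhood base, so one fits inside \<open>?N\<close>.\<close>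
    have "\<exists>U K. openin (mor \<Lambda>) U \<and> compactin (mor \<Lambda>) K \<and> segment x 0 m \<in> U \<and> U \<subseteq> K \<and> K \<subseteq> ?N"
      using locally_compact_space_neighbourhood_base[of "mor \<Lambda>"] locally_compact_mor Hausdorff_mor
      by (intro neighbourhood_base_of[THEN iffD1, rule_format] conjI N) (use xm W(2) in auto)
    then obtain U K where UK: "openin (mor \<Lambda>) U" "compactin (mor \<Lambda>) K" "segment x 0 m \<in> U"
      "U \<subseteq> K" "K \<subseteq> ?N"
      by (elim exE conjE)
    let ?F = "set_cmp \<Lambda> K E"
    let ?T = "path_cylinder U - path_cylinder ?F"
    have degK: "deg \<Lambda> \<kappa> = m" if "\<kappa> \<in> K" for \<kappa>
      using UK(5) that by auto
    have "x \<in> path_cylinder U"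
      using x m xm UK(3) unfolding path_cylinder_def by (auto intro!: bexI[of _ "segment x 0 m"])
    moreover have "x \<notin> path_cylinder ?F"
      using segment_in_set_cmp_iff[OF x m _ degK EM] UK(3,4) none by blast
    moreover have "y \<notin> boundary_paths k \<Lambda>" if y: "y \<in> path_cylinder U" "y \<notin> path_cylinder ?F" for y
    proof
      assume bd: "y \<in> boundary_paths k \<Lambda>"
      from y(1) obtain \<kappa> where yp: "y \<in> paths k \<Lambda>" and \<kappa>: "\<kappa> \<in> U"
        "enat_vec (deg \<Lambda> \<kappa>) \<le> path_deg y" "segment y 0 (deg \<Lambda> \<kappa>) = \<kappa>"
        unfolding path_cylinder_def by blast
      have \<kappa>K: "\<kappa> \<in> K" and d: "deg \<Lambda> \<kappa> = m"
        using \<kappa>(1) UK(4) degK by auto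
      have my: "enat_vec m \<le> path_deg y" "segment y 0 m \<in> K"
        using \<kappa> d \<kappa>K by auto
      have "vertex y m \<in> W"
        using pathD(3)[OF yp m(1) zero_le_vec my(1)] my(2) UK(5) by auto
      \<comment> \<open>Only the neighbourhood condition in \<open>compact_exhaustive\<close>
        mentions the vertex, and \<open>W\<close> serves for \<open>vertex y m\<close> as it did for
        \<open>vertex x m\<close>.\<close>
      then have "E \<in> compact_exhaustive \<Lambda> (vertex y m)"
        using W cE ex unfolding compact_exhaustive_def by blast
      then have "\<exists>\<mu> \<in> E. enat_vec (m + deg \<Lambda> \<mu>) \<le> path_deg y \<and> segment y m (m + deg \<Lambda> \<mu>) = \<mu>"
        using bd m(1) my(1) unfolding boundary_paths_def by blast
      then show False
        using segment_in_set_cmp_iff[OF yp m(1) my degK EM] y(2) by blast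
    qed
    moreover have "?T \<subseteq> paths k \<Lambda>"
      by (auto simp: path_cylinder_def)
    ultimately show "\<exists>T. openin (path_space k \<Lambda>) T \<and> x \<in> T \<and> T \<subseteq> paths k \<Lambda> - boundary_paths k \<Lambda>"
      using openin_path_cylinder_diff[OF UK(1) compactin_set_cmp[OF UK(2) cE]] by blast
  qed
qed

end

theorem proposition4p4:
  fixes k :: nat and \<Lambda> :: "'a graph_data"
  assumes "topological_k_graph k \<Lambda>"
  shows "closedin (path_space k \<Lambda>) (boundary_paths k \<Lambda>)"
  using assms by (rule topological_k_graph.closedin_boundary_paths)

end
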